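(* Let $N\ge1$, let $n_1,\dots,n_N\ge1$ be integers, let $f_1,\dots,f_N\in C([0,1])$, and let $G$ be a diagram (as defined in the context; it does not depend on $n$) with corresponding partition $S$. If there exists a block $s\in S$ with $|s|>2$, then $$I(G)=\prod_{s\in S}\left[(-1)^{m(s)-1}\sum_{k=1}^n\ \prod_{v\in F:\ \psi(v)\in s} f_{i(v)}\left(\frac{k}{n}\right)\frac{1}{\sqrt n}\right]\longrightarrow 0,\qquad n\to\infty.$$
   Context: Vertices: $F=\{f_i^j:\ 1\le i\le N,\ 1\le j\le n_i\}$ is a set of $K=\sum_{i=1}^N n_i$ formal vertices; $\psi:F\to\{1,\dots,K\}$ is a fixed bijection, and $i(v)=i$ for $v=f_i^j$. Diagrams: let $\Pi$ be the set of all partitions of $\{1,\dots,K\}$ in which every block has even cardinality and no block consists only of numbers of vertices with one and the same index $i$. A diagram $G$ is a choice of a partition $S\in\Pi$ together with, for every block $s\in S$, an ordering of its elements $(a_1,\dots,a_{|s|})$ such that $a_1=\min s$ (the remaining elements being in arbitrary order). For an ordered block $s$, $m(s)$ is the number of pairs $(a_r,a_{r+1})$ of neighbouring elements with $a_r\le a_{r+1}$. In $I(G)$ the factor $\frac{1}{\sqrt n}$ is inside the product over $v$ (one factor per vertex). *)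

theory Defs
  imports Complex_Main "HOL-Library.Disjoint_Sets" "HOL-Library.FuncSet"
    "HOL-Combinatorics.Multiset_Permutations"
begin

(* The formal vertex f_i^j is encoded as the pair (i, j), so that i(v) = fst v. *)
definition vertices :: "nat \<Rightarrow> (nat \<Rightarrow> nat) \<Rightarrow> (nat \<times> nat) set" where
  "vertices N ns = (SIGMA i:{1..N}. {1..ns i})"

definition num_vertices :: "nat \<Rightarrow> (nat \<Rightarrow> nat) \<Rightarrow> nat" where
  "num_vertices N ns = (\<Sum>i=1..N. ns i)"

definition is_numbering :: "nat \<Rightarrow> (nat \<Rightarrow> nat) \<Rightarrow> (nat \<times> nat \<Rightarrow> nat) \<Rightarrow> bool" where
  "is_numbering N ns \<psi> \<longleftrightarrow> bij_betw \<psi> (vertices N ns) {1..num_vertices N ns}"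

definition admissible_partitions ::
    "nat \<Rightarrow> (nat \<Rightarrow> nat) \<Rightarrow> (nat \<times> nat \<Rightarrow> nat) \<Rightarrow> nat set set set" where
  "admissible_partitions N ns \<psi> =
     {S. partition_on {1..num_vertices N ns} S \<and>
         (\<forall>s\<in>S. even (card s)) \<and>
         (\<forall>s\<in>S. \<not> (\<exists>i. \<forall>v\<in>vertices N ns. \<psi> v \<in> s \<longrightarrow> fst v = i))}"

definition block_orderings :: "nat set \<Rightarrow> nat list set" where
  "block_orderings s = {as \<in> permutations_of_set s. hd as = Min s}"

(* A diagram is a partition S with a family of orderings of its blocks; the family is an
   extensional function on S, so it carries no data outside S. *)
definition diagrams ::
    "nat \<Rightarrow> (nat \<Rightarrow> nat) \<Rightarrow> (nat \<times> nat \<Rightarrow> nat) \<Rightarrow> (nat set set \<times> (nat set \<Rightarrow> nat list)) set" where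
  "diagrams N ns \<psi> = (SIGMA S:admissible_partitions N ns \<psi>. \<Pi>\<^sub>E s\<in>S. block_orderings s)"

definition num_ascents :: "nat list \<Rightarrow> nat" where
  "num_ascents as = card {r. Suc r < length as \<and> as ! r \<le> as ! Suc r}"

(* The exponent is an integer, so that no truncated subtraction occurs. *)
definition diagram_value ::
    "nat \<Rightarrow> (nat \<Rightarrow> nat) \<Rightarrow> (nat \<times> nat \<Rightarrow> nat) \<Rightarrow> (nat \<Rightarrow> real \<Rightarrow> real) \<Rightarrow>
     nat set set \<times> (nat set \<Rightarrow> nat list) \<Rightarrow> nat \<Rightarrow> real" where
  "diagram_value N ns \<psi> f G n =
     (\<Prod>s\<in>fst G. (-1) powi (int (num_ascents (snd G s)) - 1) *
        (\<Sum>k=1..n. \<Prod>v\<in>{v \<in> vertices N ns. \<psi> v \<in> s}.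
           f (fst v) (real k / real n) * (1 / sqrt (real n))))"

end

theory Submission
  imports Defs
begin

text \<open>
  If every \<open>f\<^sub>i\<close> is bounded by \<open>B\<close>, a block with \<open>c \<ge> 2\<close> elements contributes a factor of
  absolute value at most \<open>n \<cdot> (B / \<surd>n)\<^sup>c = B\<^sup>c \<cdot> (1 / \<surd>n)\<^bsup>c - 2\<^esup>\<close>. All these factors are
  bounded, and a block with \<open>c > 2\<close> contributes one that vanishes in the limit.
\<close>

text \<open>Each \<open>\<bar>f i x\<bar>\<close> attains its maximum on the compact interval, and
  finitely many such bounds are dominated by one constant.\<close>

lemma continuous_on_Icc_uniform_bound:
  fixes f :: "'i \<Rightarrow> real \<Rightarrow> real"
  assumes "finite I" and "\<And>i. i \<in> I \<Longrightarrow> continuous_on {a..b} (f i)"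
  obtains B where "B \<ge> 0" and "\<And>i x. i \<in> I \<Longrightarrow> x \<in> {a..b} \<Longrightarrow> \<bar>f i x\<bar> \<le> B"
proof -
  have "\<exists>C. \<forall>x\<in>{a..b}. \<bar>f i x\<bar> \<le> C" if "i \<in> I" for i
  proof (cases "{a..b} = {}")
    case False
    have "continuous_on {a..b} (\<lambda>x. \<bar>f i x\<bar>)"
      using assms(2)[OF that] by (intro continuous_intros)
    from continuous_attains_sup[OF compact_Icc False this] show ?thesis by blast
  qed auto
  then obtain C where C: "\<And>i x. i \<in> I \<Longrightarrow> x \<in> {a..b} \<Longrightarrow> \<bar>f i x\<bar> \<le> C i"
    by metis
  show thesis
  \<comment> \<open>A sum of absolute values, rather than a maximum, is nonnegative and makes sense
    for empty \<open>I\<close> as well.\<close>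
  proof (rule that[of "\<Sum>i\<in>I. \<bar>C i\<bar>"])
    fix i x assume i: "i \<in> I" and x: "x \<in> {a..b}"
    have "\<bar>f i x\<bar> \<le> \<bar>C i\<bar>"
      using C[OF i x] by linarith
    also have "\<dots> \<le> (\<Sum>i\<in>I. \<bar>C i\<bar>)"
      using i assms(1) by (intro member_le_sum) auto
    finally show "\<bar>f i x\<bar> \<le> (\<Sum>i\<in>I. \<bar>C i\<bar>)" .
  qed (simp add: sum_nonneg)
qed

text \<open>Each of the \<open>n\<close> summands is at most \<open>(B / sqrt n) ^ card V\<close>.
  Two of the factors \<open>1 / sqrt n\<close> absorb the number of summands, which leaves the
  exponent \<open>card V - 2\<close>.\<close>

lemma abs_normalized_sum_prod_le:
  fixes g :: "'v \<Rightarrow> real \<Rightarrow> real" and n :: nat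
  assumes "B \<ge> 0" and "\<And>v x. v \<in> V \<Longrightarrow> x \<in> {0..1} \<Longrightarrow> \<bar>g v x\<bar> \<le> B"
    and "card V \<ge> 2"
  shows "\<bar>\<Sum>k=1..n. \<Prod>v\<in>V. g v (real k / real n) * (1 / sqrt (real n))\<bar>
           \<le> B ^ card V * (1 / sqrt (real n)) ^ (card V - 2)"
\<comment> \<open>For \<open>n = 0\<close> the sum is empty and \<open>1 / sqrt 0\<close> is 0 by
  convention, so only nonnegativity of the right-hand side is at stake.\<close>
proof (cases "n = 0")
  case True
  then show ?thesis using assms(1) by simp
next
  case False
  have "\<bar>\<Prod>v\<in>V. g v (real k / real n) * (1 / sqrt (real n))\<bar> \<le> (B * (1 / sqrt (real n))) ^ card V"
    if "k \<in> {1..n}" for k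
  proof -
    have "real k / real n \<in> {0..1}"
      using that False by (auto simp: field_simps)
    then have "(\<Prod>v\<in>V. \<bar>g v (real k / real n) * (1 / sqrt (real n))\<bar>)
        \<le> (\<Prod>v\<in>V. B * (1 / sqrt (real n)))"
      using assms(2) by (intro prod_mono) (auto simp: abs_mult divide_right_mono)
    then show ?thesis
      by (simp only: abs_prod prod_constant)
  qed
  then have "\<bar>\<Sum>k=1..n. \<Prod>v\<in>V. g v (real k / real n) * (1 / sqrt (real n))\<bar>
      \<le> (\<Sum>k=1..n. (B * (1 / sqrt (real n))) ^ card V)"
    by (intro order_trans[OF sum_abs] sum_mono)
  also have "\<dots> = B ^ card V * (real n * (1 / sqrt (real n)) ^ card V)"
    by (simp only: power_mult_distrib) simp
  also have "(1 / sqrt (real n)) ^ card V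
      = (1 / sqrt (real n)) ^ 2 * (1 / sqrt (real n)) ^ (card V - 2)"
    using assms(3) by (metis le_add_diff_inverse power_add)
  also have "real n * \<dots> = (1 / sqrt (real n)) ^ (card V - 2)"
    using False by (simp add: power_divide)
  finally show ?thesis .
qed

text \<open>The numbering restricts to a bijection from the preimage of \<open>s\<close> onto
  \<open>s\<close>. This turns the number of factors in a block's product into
  \<open>card s\<close>.\<close>

lemma card_vertices_of_block:
  assumes "is_numbering N ns \<psi>" and "s \<subseteq> {1..num_vertices N ns}"
  shows "card {v \<in> vertices N ns. \<psi> v \<in> s} = card s"
proof -
  have "\<psi> ` vertices N ns = {1..num_vertices N ns}" "inj_on \<psi> (vertices N ns)"
    using assms(1) by (auto simp: is_numbering_def bij_betw_def)
  then have "bij_betw \<psi> {v \<in> vertices N ns. \<psi> v \<in> s} s"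
    using assms(2) by (auto simp: bij_betw_def inj_on_def)
  then show ?thesis
    by (rule bij_betw_same_card)
qed

text \<open>Blocks are finite and nonempty, so their even cardinality is positive.\<close>

lemma admissible_partition_card_ge_2:
  assumes "S \<in> admissible_partitions N ns \<psi>" and "s \<in> S"
  shows "card s \<ge> 2"
proof -
  have "s \<subseteq> {1..num_vertices N ns}" "s \<noteq> {}" and even: "even (card s)"
    using assms by (auto simp: admissible_partitions_def partition_on_def)
  then have "card s \<noteq> 0"
    using finite_subset by fastforce
  with even show ?thesis
    by (metis One_nat_def less_2_cases_iff not_less odd_one)
qed

theorem lemma4:
  fixes N :: nat and ns :: "nat \<Rightarrow> nat" and \<psi> :: "nat \<times> nat \<Rightarrow> nat"
    and f :: "nat \<Rightarrow> real \<Rightarrow> real"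
    and S :: "nat set set" and ord :: "nat set \<Rightarrow> nat list"
  assumes "N \<ge> 1"
    and "\<And>i. i \<in> {1..N} \<Longrightarrow> ns i \<ge> 1"
    and "\<And>i. i \<in> {1..N} \<Longrightarrow> continuous_on {0..1} (f i)"
    and "is_numbering N ns \<psi>"
    and "(S, ord) \<in> diagrams N ns \<psi>"
    and "\<exists>s\<in>S. card s > 2"
  shows "(\<lambda>n. diagram_value N ns \<psi> f (S, ord) n) \<longlonglongrightarrow> 0"
proof -
  have adm: "S \<in> admissible_partitions N ns \<psi>"
    using assms(5) by (simp add: diagrams_def)
  then have part: "partition_on {1..num_vertices N ns} S"
    by (simp add: admissible_partitions_def)
  then have fin: "finite S"
    by (rule finite_elements[OF finite_atLeastAtMost])
  obtain B where B: "B \<ge> 0" "\<And>i x. i \<in> {1..N} \<Longrightarrow> x \<in> {0..1} \<Longrightarrow> \<bar>f i x\<bar> \<le> B"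
    using continuous_on_Icc_uniform_bound[of "{1..N}" 0 1 f] assms(3) by blast
  let ?b = "\<lambda>n. \<Prod>s\<in>S. B ^ card s * (1 / sqrt (real n)) ^ (card s - 2)"
  have bound: "\<bar>diagram_value N ns \<psi> f (S, ord) n\<bar> \<le> ?b n" for n
  proof -
    have "\<bar>\<Sum>k=1..n. \<Prod>v\<in>{v \<in> vertices N ns. \<psi> v \<in> s}.
            f (fst v) (real k / real n) * (1 / sqrt (real n))\<bar>
          \<le> B ^ card s * (1 / sqrt (real n)) ^ (card s - 2)" if "s \<in> S" for s
    proof -
      have "s \<subseteq> {1..num_vertices N ns}"
        using part that by (auto simp: partition_on_def)
      note card = card_vertices_of_block[OF assms(4) this]
      show ?thesis
        using abs_normalized_sum_prod_le
          [of B "{v \<in> vertices N ns. \<psi> v \<in> s}" "\<lambda>v. f (fst v)" n, unfolded card]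
          B admissible_partition_card_ge_2[OF adm that]
        by (auto simp: vertices_def)
    qed
    then show ?thesis
      \<comment> \<open>The signs have absolute value 1, so the block orderings do not affect the
        estimate.\<close>
      unfolding diagram_value_def fst_conv abs_prod
      by (intro prod_mono) (simp add: abs_mult power_int_abs)
  qed
  have "(\<lambda>n. 1 / sqrt (real n)) \<longlonglongrightarrow> 0"
    by (intro tendsto_divide_0[OF tendsto_const] filterlim_at_top_imp_at_infinity
          filterlim_compose[OF sqrt_at_top filterlim_real_sequentially])
  \<comment> \<open>\<open>S\<close> and all exponents are independent of \<open>n\<close>, so the
    limit can be taken factor by factor. Since \<open>0 ^ 0 = 1\<close>, a block of size 2 keeps the
    factor \<open>B ^ 2\<close>, while any larger block contributes 0 and annihilates the
    product.\<close>
  then have "?b \<longlonglongrightarrow> (\<Prod>s\<in>S. B ^ card s * 0 ^ (card s - 2))"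
    by (intro tendsto_prod tendsto_mult tendsto_const tendsto_power)
  moreover have "(\<Prod>s\<in>S. B ^ card s * 0 ^ (card s - 2)) = 0"
    using assms(6) fin by (auto simp: prod_zero_iff)
  ultimately have lim: "?b \<longlonglongrightarrow> 0"
    by simp
  have "(\<lambda>n. \<bar>diagram_value N ns \<psi> f (S, ord) n\<bar>) \<longlonglongrightarrow> 0"
    by (rule tendsto_sandwich[OF _ _ tendsto_const lim]) (simp_all add: bound)
  then show ?thesis
    by (rule tendsto_rabs_zero_cancel)
qed

end
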